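(* Let $n_1,n_2,n_3\in\mathbb{N}_0$, $n=n_1+n_2+n_3$, and let $\alpha,\beta,\gamma,\delta$ be real parameters. The polynomials $P_{n_1,n_2,n_3}^{(\alpha,\beta,\gamma,\delta)}$ defined in the context satisfy the following four relations (all polynomials evaluated at $(x,y,z)$). (1) $$\begin{aligned}&(2n_2+2n_3+\beta+\gamma+\delta+2)\left(\frac{\partial}{\partial x}-\frac{\partial}{\partial y}\right)P_{n_1,n_2,n_3}^{(\alpha,\beta,\gamma,\delta)}\\&=(n_2+2n_3+\beta+\gamma+\delta+2)(n+n_2+n_3+\alpha+\beta+\gamma+\delta+3)\,P_{n_1-1,n_2,n_3}^{(\alpha+1,\beta+1,\gamma,\delta)}\\&\quad-(n_1+2n_2+2n_3+\beta+\gamma+\delta+2)(n_2+2n_3+\gamma+\delta+1)\,P_{n_1,n_2-1,n_3}^{(\alpha+1,\beta+1,\gamma,\delta)};\end{aligned}$$ (2) $$\begin{aligned}&(2n_3+\gamma+\delta+1)\left(\frac{\partial}{\partial z}-\frac{\partial}{\partial y}\right)P_{n_1,n_2,n_3}^{(\alpha,\beta,\gamma,\delta)}\\&=(n_3+\delta)(n_2+2n_3+\gamma+\delta+1)\,P_{n_1,n_2,n_3-1}^{(\alpha,\beta+1,\gamma+1,\delta)}\\&\quad-(n_2+2n_3+\beta+\gamma+\delta+2)(n_3+\gamma+\delta+1)\,P_{n_1,n_2-1,n_3}^{(\alpha,\beta+1,\gamma+1,\delta)};\end{aligned}$$ (3) $$\frac{\partial}{\partial z}P_{n_1,n_2,n_3}^{(\alpha,\beta,\gamma,\delta)}=(n_3+\gamma+\delta+1)\,P_{n_1,n_2,n_3-1}^{(\alpha,\beta,\gamma+1,\delta+1)};$$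 (4) $$\begin{aligned}&(2n_2+2n_3+\beta+\gamma+\delta+2)\frac{\partial}{\partial z}\left(\frac{\partial}{\partial x}-\frac{\partial}{\partial y}\right)P_{n_1,n_2,n_3}^{(\alpha,\beta,\gamma,\delta)}\\&=(n_2+2n_3+\beta+\gamma+\delta+2)(n+n_2+n_3+\alpha+\beta+\gamma+\delta+3)(n_3+\gamma+\delta+1)\,P_{n_1-1,n_2,n_3-1}^{(\alpha+1,\beta+1,\gamma+1,\delta+1)}\\&\quad-(n_1+2n_2+2n_3+\beta+\gamma+\delta+2)(n_2+2n_3+\gamma+\delta+1)(n_3+\gamma+\delta+1)\,P_{n_1,n_2-1,n_3-1}^{(\alpha+1,\beta+1,\gamma+1,\delta+1)}.\end{aligned}$$
   Context: Jacobi polynomials: for $n\in\mathbb{N}_0=\{0,1,2,\dots\}$ and real $p,q$, $$P_n^{(p,q)}(t)=\frac{(-1)^n}{2^n n!}(1-t)^{-p}(1+t)^{-q}\frac{d^n}{dt^n}\left\{(1-t)^{n+p}(1+t)^{n+q}\right\}$$ (a polynomial in $t$). Points $(x,y,z)$ range over the simplex $\mathbb{T}^3=\{(x,y,z)\in\mathbb{R}^3: x,y,z>0,\ 1-x-y-z>0\}$. Koornwinder polynomials in three variables on the simplex: for $n_1,n_2,n_3\in\mathbb{N}_0$, $$P_{n_1,n_2,n_3}^{(\alpha,\beta,\gamma,\delta)}(x,y,z)=P_{n_1}^{(\beta+\gamma+\delta+2n_2+2n_3+2,\,\alpha)}(2x-1)\,(1-x)^{n_2}\,P_{n_2}^{(\gamma+\delta+2n_3+1,\,\beta)}\!\left(\tfrac{2y}{1-x}-1\right)(1-x-y)^{n_3}\,P_{n_3}^{(\delta,\gamma)}\!\left(\tfrac{2z}{1-x-y}-1\right).$$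 A polynomial with a negative index is zero by convention. *)

theory Defs
  imports "HOL-Analysis.Analysis"
begin

definition simplex3 :: "(real \<times> real \<times> real) set" where
  "simplex3 = {(x, y, z). 0 < x \<and> 0 < y \<and> 0 < z \<and> 0 < 1 - x - y - z}"

text \<open>
  Rodrigues' formula. It is meaningful only for \<open>-1 < t < 1\<close>, where both bases of the real
  powers are positive; there it is a polynomial in \<open>t\<close> for all real \<open>p\<close>, \<open>q\<close>. On the open
  simplex all the arguments at which it is used below lie in this interval.
\<close>
definition jacobi :: "nat \<Rightarrow> real \<Rightarrow> real \<Rightarrow> real \<Rightarrow> real" where
  "jacobi n p q t =
     (-1) ^ n / (2 ^ n * fact n) * (1 - t) powr (- p) * (1 + t) powr (- q) *
     (deriv ^^ n) (\<lambda>s. (1 - s) powr (real n + p) * (1 + s) powr (real n + q)) t"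

text \<open>The indices are integers so that the convention for negative indices can be expressed.\<close>
definition koornwinder ::
  "real \<Rightarrow> real \<Rightarrow> real \<Rightarrow> real \<Rightarrow> int \<Rightarrow> int \<Rightarrow> int \<Rightarrow> real \<Rightarrow> real \<Rightarrow> real \<Rightarrow> real" where
  "koornwinder \<alpha> \<beta> \<gamma> \<delta> n1 n2 n3 x y z =
     (if n1 < 0 \<or> n2 < 0 \<or> n3 < 0 then 0
      else
        jacobi (nat n1) (\<beta> + \<gamma> + \<delta> + 2 * of_int n2 + 2 * of_int n3 + 2) \<alpha> (2 * x - 1) *
        (1 - x) ^ nat n2 *
        jacobi (nat n2) (\<gamma> + \<delta> + 2 * of_int n3 + 1) \<beta> (2 * y / (1 - x) - 1) *
        (1 - x - y) ^ nat n3 *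
        jacobi (nat n3) \<delta> \<gamma> (2 * z / (1 - x - y) - 1))"

definition partial_x ::
  "(real \<Rightarrow> real \<Rightarrow> real \<Rightarrow> real) \<Rightarrow> real \<Rightarrow> real \<Rightarrow> real \<Rightarrow> real" where
  "partial_x f x y z = deriv (\<lambda>s. f s y z) x"

definition partial_y ::
  "(real \<Rightarrow> real \<Rightarrow> real \<Rightarrow> real) \<Rightarrow> real \<Rightarrow> real \<Rightarrow> real \<Rightarrow> real" where
  "partial_y f x y z = deriv (\<lambda>s. f x s z) y"

definition partial_z ::
  "(real \<Rightarrow> real \<Rightarrow> real \<Rightarrow> real) \<Rightarrow> real \<Rightarrow> real \<Rightarrow> real \<Rightarrow> real" where
  "partial_z f x y z = deriv (\<lambda>s. f x y s) z"

end

theory Submission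
  imports Defs
begin

text \<open>
  A Jacobi polynomial \<open>P\<close> of degree \<open>n\<close> with parameters \<open>p, q\<close> is best seen as a binary form
  \<open>H(n; p, q)(w, y)\<close>, homogeneous of degree \<open>n\<close>, restricted to \<open>w = (1 - t) / 2\<close>,
  \<open>y = (1 + t) / 2\<close>. The powers of \<open>1 - x\<close> and \<open>1 - x - y\<close> in the Koornwinder polynomial
  are exactly the ones that homogenise its second and third factor, so on the simplex it is the product
  \<open>H(n1; a, \<alpha>)(1 - x, x) * H(n2; b, \<beta>)(1 - x - y, y) * H(n3; \<delta>, \<gamma>)(1 - x - y - z, z)\<close>
  with \<open>b = \<gamma> + \<delta> + 2 n3 + 1\<close> and \<open>a = b + \<beta> + 2 n2 + 1\<close>. All the arguments are now
  affine in \<open>x, y, z\<close>: the operator \<open>d/dx - d/dy\<close> leaves both arguments of the third form alone and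
  moves only \<open>y\<close> in the second one, and \<open>d/dz - d/dy\<close> leaves the first form and the first argument of
  the third one alone.

  The partial derivatives of a form lower its degree and raise one parameter:
  \<open>d/dy H(n; p, q) = (n + p) H(n - 1; p, q + 1)\<close> and
  \<open>d/dw H(n; p, q) = - (n + q) H(n - 1; p + 1, q)\<close>; together they give Euler's relation
  (\<open>jacobi_form_euler\<close>). Pascal's rule gives the two relations \<open>jacobi_form_pascal_right\<close> and
  \<open>jacobi_form_pascal_left\<close>. Everything else is a linear combination of these: the derivative
  along \<open>w + y = const\<close> (\<open>jacobi_form_lower_sum\<close>), the two contiguity relations
  \<open>jacobi_form_lower_left_parameter\<close> and \<open>jacobi_form_raise_right_parameter\<close>, and the recursion
  \<open>jacobi_form_rodrigues_step\<close>, which is what one differentiation does in Rodrigues' formula and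
  so identifies the forms with the Jacobi polynomials (\<open>jacobi_eq_form\<close>).

  The relations for \<open>d/dx - d/dy\<close> and \<open>d/dz - d/dy\<close> arise in the same way. Applying the operator to the
  two affected factors gives two products of forms whose parameters are not yet those of the claim. One
  multiplies by the left parameter of the first affected factor, rewrites it by the relation that lowers
  the left parameter and the other factor by the relation that raises the right one; the two terms that
  do not belong to the claim then cancel. The relation for \<open>d/dz\<close> is the derivative along
  \<open>w + y = const\<close>, and the mixed one is the \<open>z\<close>-derivative of the relation for \<open>d/dx - d/dy\<close>.
\<close>

section \<open>Jacobi polynomials as binary forms\<close>

text \<open>
  The degree is an integer and forms of negative degree vanish, so that the relations below, which lower
  the degree, hold in degree 0 as well and match the convention for negative indices.
\<close>
definition jacobi_form :: "int \<Rightarrow> real \<Rightarrow> real \<Rightarrow> real \<Rightarrow> real \<Rightarrow> real" where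
  "jacobi_form n p q w y = (if n < 0 then 0 else
     (\<Sum>k\<le>nat n. ((of_int n + p) gchoose (nat n - k)) * ((of_int n + q) gchoose k)
        * (- w) ^ k * y ^ (nat n - k)))"

lemma jacobi_form_neg [simp]: "n < 0 \<Longrightarrow> jacobi_form n p q w y = 0"
  by (simp add: jacobi_form_def)

lemma jacobi_form_int:
  "jacobi_form (int n) p q w y =
     (\<Sum>k\<le>n. ((real n + p) gchoose (n - k)) * ((real n + q) gchoose k) * (- w) ^ k * y ^ (n - k))"
  by (simp add: jacobi_form_def)

lemma jacobi_form_0 [simp]: "jacobi_form 0 p q w y = 1"
  by (simp add: jacobi_form_def)

lemma int_index_cases:
  fixes n :: int
  obtains "n < 0" | "n = 0" | m where "n = int (Suc m)"
proof -
  have "n < 0 \<or> n = 0 \<or> n = int (Suc (nat (n - 1)))"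
    by auto
  then show ?thesis
    using that by blast
qed

text \<open>
  Reversing the sum exchanges the two binomial coefficients. Keeping the signs inside the arguments avoids
  a factor \<open>(- 1) ^ n\<close>. This symmetry carries Pascal's relation from the right to the left parameter,
  and the derivative with respect to \<open>y\<close> to the one with respect to \<open>w\<close>.
\<close>
lemma jacobi_form_swap: "jacobi_form n p q w y = jacobi_form n q p (- y) (- w)"
proof (cases "n < 0")
  case False
  define m where "m = nat n"
  have n: "n = int m"
    using False by (simp add: m_def)
  have "jacobi_form n q p (- y) (- w) =
    (\<Sum>k\<le>m. ((real m + q) gchoose (m - (m - k))) * ((real m + p) gchoose (m - k))
        * y ^ (m - k) * (- w) ^ (m - (m - k)))"
    unfolding n jacobi_form_int minus_minus
    by (rule sum.reindex_bij_witness[of _ "\<lambda>k. m - k" "\<lambda>k. m - k"]) auto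
  also have "\<dots> = jacobi_form n p q w y"
    unfolding n jacobi_form_int by (intro sum.cong) (auto simp: mult_ac)
  finally show ?thesis ..
qed simp

lemma jacobi_form_homogeneous:
  "jacobi_form (int n) p q (c * w) (c * y) = c ^ n * jacobi_form (int n) p q w y"
proof -
  have "(- (c * w)) ^ k * (c * y) ^ (n - k) = c ^ n * ((- w) ^ k * y ^ (n - k))" if "k \<le> n" for k
  proof -
    have "c ^ n = c ^ k * c ^ (n - k)"
      using that by (simp flip: power_add)
    moreover have "(- (c * w)) ^ k = c ^ k * (- w) ^ k"
      by (simp flip: power_mult_distrib)
    ultimately show ?thesis
      by (simp add: power_mult_distrib)
  qed
  then show ?thesis
    unfolding jacobi_form_int sum_distrib_left
    by (intro sum.cong) (auto simp: mult.assoc mult.left_commute)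
qed

text \<open>
  The top of the binomial coefficient with lower index \<open>n - k\<close> is the same in all three terms, and the
  other coefficient obeys Pascal's rule; the index shift in its second summand produces the factor \<open>w\<close>.
\<close>
lemma jacobi_form_pascal_right:
  "jacobi_form n p (q + 1) w y = jacobi_form n p q w y - w * jacobi_form (n - 1) (p + 1) (q + 1) w y"
proof (cases n rule: int_index_cases)
  case (3 m)
  have n1: "n - 1 = int m"
    using 3 by simp
  define c where "c k = ((1 + real m + p) gchoose (Suc m - k))" for k
  define X where "X k = ((1 + real m + q) gchoose k)" for k
  define M where "M k = (- w) ^ k * y ^ (Suc m - k)" for k
  have S1: "jacobi_form n p (q + 1) w y = (\<Sum>k\<le>Suc m. c k * ((1 + real m + q + 1) gchoose k) * M k)"
    unfolding 3 jacobi_form_int c_def M_def by (simp add: mult.assoc add_ac)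
  have S2: "jacobi_form n p q w y = (\<Sum>k\<le>Suc m. c k * X k * M k)"
    unfolding 3 jacobi_form_int c_def M_def X_def by (simp add: mult.assoc)
  have S3: "w * jacobi_form (n - 1) (p + 1) (q + 1) w y = - (\<Sum>k\<le>m. c (Suc k) * X k * M (Suc k))"
    unfolding n1 jacobi_form_int c_def M_def X_def sum_distrib_left sum_negf[symmetric]
    by (intro sum.cong) (auto simp: add_ac mult_ac)
  have pascal: "((1 + real m + q + 1) gchoose (Suc k)) = X k + X (Suc k)" for k
    unfolding X_def by (rule gbinomial_Suc_Suc)
  show ?thesis
    unfolding S1 S2 S3 sum.atMost_Suc_shift pascal
    by (simp add: X_def algebra_simps sum.distrib)
qed simp_all

lemma jacobi_form_pascal_left:
  "jacobi_form n (p + 1) q w y = jacobi_form n p q w y + y * jacobi_form (n - 1) (p + 1) (q + 1) w y"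
  using jacobi_form_pascal_right[of n q p "- y" "- w"] by (simp flip: jacobi_form_swap)

section \<open>Derivatives and contiguity relations\<close>

text \<open>
  The two sums that follow are the termwise derivatives with respect to \<open>y\<close> and to \<open>- w\<close>. The factor
  brought down by the power is absorbed into the binomial coefficient with the same lower index.
\<close>
lemma jacobi_form_termwise_dy:
  "(\<Sum>k\<le>n. ((real n + p) gchoose (n - k)) * ((real n + q) gchoose k)
        * ((- w) ^ k * (real (n - k) * y ^ (n - k - 1))))
   = (real n + p) * jacobi_form (int n - 1) p (q + 1) w y"
proof (cases n)
  case (Suc m)
  have i: "int n - 1 = int m"
    using Suc by simp
  have *: "((real n + p) gchoose (n - k)) * real (n - k) = (real n + p) * ((real m + p) gchoose (m - k))"
    if "k \<le> m" for k
    using gbinomial_absorption[of "m - k" "real n + p"] that Suc by (simp add: Suc_diff_le mult.commute add_ac)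
  have "(\<Sum>k\<le>n. ((real n + p) gchoose (n - k)) * ((real n + q) gchoose k)
        * ((- w) ^ k * (real (n - k) * y ^ (n - k - 1))))
     = (\<Sum>k\<le>m. (((real n + p) gchoose (n - k)) * real (n - k)) * ((real n + q) gchoose k)
        * (- w) ^ k * y ^ (m - k))"
    by (auto simp: Suc mult_ac intro!: sum.cong)
  also have "\<dots> = (\<Sum>k\<le>m. (real n + p) * (((real m + p) gchoose (m - k)) * ((real m + (q + 1)) gchoose k)
        * (- w) ^ k * y ^ (m - k)))"
    by (intro sum.cong refl, subst *) (auto simp: Suc add_ac mult_ac)
  also have "\<dots> = (real n + p) * jacobi_form (int n - 1) p (q + 1) w y"
    unfolding i jacobi_form_int sum_distrib_left ..
  finally show ?thesis .
qed simp

lemma jacobi_form_termwise_dw: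
  "(\<Sum>k\<le>n. ((real n + p) gchoose (n - k)) * ((real n + q) gchoose k)
        * (real k * (- w) ^ (k - 1) * y ^ (n - k)))
   = (real n + q) * jacobi_form (int n - 1) (p + 1) q w y"
proof -
  have "(\<Sum>k\<le>n. ((real n + p) gchoose (n - k)) * ((real n + q) gchoose k)
        * (real k * (- w) ^ (k - 1) * y ^ (n - k)))
    = (\<Sum>k\<le>n. ((real n + q) gchoose (n - k)) * ((real n + p) gchoose k)
        * ((- (- y)) ^ k * (real (n - k) * (- w) ^ (n - k - 1))))"
    by (rule sum.reindex_bij_witness[of _ "\<lambda>k. n - k" "\<lambda>k. n - k"]) (auto simp: mult_ac)
  also have "\<dots> = (real n + q) * jacobi_form (int n - 1) q (p + 1) (- y) (- w)"
    by (rule jacobi_form_termwise_dy)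
  finally show ?thesis
    by (simp flip: jacobi_form_swap)
qed

lemma jacobi_form_deriv:
  assumes "(w has_real_derivative w') (at s)" "(y has_real_derivative y') (at s)"
  shows "((\<lambda>s. jacobi_form n p q (w s) (y s)) has_real_derivative
     (of_int n + p) * jacobi_form (n - 1) p (q + 1) (w s) (y s) * y'
     - (of_int n + q) * jacobi_form (n - 1) (p + 1) q (w s) (y s) * w') (at s)"
proof (cases "n < 0")
  case False
  define m where "m = nat n"
  have n: "n = int m"
    using False by (simp add: m_def)
  have "((\<lambda>s. jacobi_form (int m) p q (w s) (y s)) has_real_derivative
     (\<Sum>k\<le>m. ((real m + p) gchoose (m - k)) * ((real m + q) gchoose k)
        * ((- w s) ^ k * (real (m - k) * y s ^ (m - k - 1)))) * y'
     - (\<Sum>k\<le>m. ((real m + p) gchoose (m - k)) * ((real m + q) gchoose k)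
        * (real k * (- w s) ^ (k - 1) * y s ^ (m - k))) * w') (at s)"
    (is "(_ has_real_derivative ?D) _")
  proof -
    have "((\<lambda>s. jacobi_form (int m) p q (w s) (y s)) has_real_derivative
       (\<Sum>k\<le>m. ((real m + p) gchoose (m - k)) * ((real m + q) gchoose k)
          * ((- w s) ^ k * (real (m - k) * y s ^ (m - k - 1)) * y'
             - real k * (- w s) ^ (k - 1) * y s ^ (m - k) * w'))) (at s)"
      unfolding jacobi_form_int
    proof (rule DERIV_sum)
      fix k
      have "((\<lambda>s. (- w s) ^ k * y s ^ (m - k)) has_real_derivative
          (- w s) ^ k * (real (m - k) * y s ^ (m - k - 1)) * y'
             - real k * (- w s) ^ (k - 1) * y s ^ (m - k) * w') (at s)"
        by (auto intro!: derivative_eq_intros assms)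
      from DERIV_cmult[OF this, of "((real m + p) gchoose (m - k)) * ((real m + q) gchoose k)"]
      show "((\<lambda>s. ((real m + p) gchoose (m - k)) * ((real m + q) gchoose k) * (- w s) ^ k * y s ^ (m - k))
        has_real_derivative ((real m + p) gchoose (m - k)) * ((real m + q) gchoose k)
          * ((- w s) ^ k * (real (m - k) * y s ^ (m - k - 1)) * y'
             - real k * (- w s) ^ (k - 1) * y s ^ (m - k) * w')) (at s)"
        by (simp only: mult.assoc)
    qed
    moreover have "(\<Sum>k\<le>m. ((real m + p) gchoose (m - k)) * ((real m + q) gchoose k)
          * ((- w s) ^ k * (real (m - k) * y s ^ (m - k - 1)) * y'
             - real k * (- w s) ^ (k - 1) * y s ^ (m - k) * w')) = ?D"
      unfolding sum_distrib_right sum_subtractf[symmetric]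
      by (intro sum.cong refl) (simp only: right_diff_distrib mult.assoc)
    ultimately show ?thesis
      by simp
  qed
  then show ?thesis
    unfolding jacobi_form_termwise_dy jacobi_form_termwise_dw n by simp
qed simp

text \<open>Euler's relation for a homogeneous function of degree \<open>n\<close>, with the partial derivatives inserted.\<close>
lemma jacobi_form_euler:
  "of_int n * jacobi_form n p q w y =
     y * (of_int n + p) * jacobi_form (n - 1) p (q + 1) w y
     - w * (of_int n + q) * jacobi_form (n - 1) (p + 1) q w y"
proof (cases "n < 0")
  case False
  define m where "m = nat n"
  have n: "n = int m"
    using False by (simp add: m_def)
  have monomial: "real m * ((- w) ^ k * y ^ (m - k))
    = y * ((- w) ^ k * (real (m - k) * y ^ (m - k - 1)))
      - w * (real k * (- w) ^ (k - 1) * y ^ (m - k))" if "k \<le> m" for k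
  proof -
    have "y * (real (m - k) * y ^ (m - k - 1)) = real (m - k) * y ^ (m - k)"
      by (cases "m - k") auto
    moreover have "w * (real k * (- w) ^ (k - 1)) = - (real k * (- w) ^ k)"
      by (cases k) auto
    moreover have "y * ((- w) ^ k * (real (m - k) * y ^ (m - k - 1)))
        - w * (real k * (- w) ^ (k - 1) * y ^ (m - k))
      = (- w) ^ k * (y * (real (m - k) * y ^ (m - k - 1)))
        - w * (real k * (- w) ^ (k - 1)) * y ^ (m - k)"
      by (simp only: mult_ac)
    ultimately have "y * ((- w) ^ k * (real (m - k) * y ^ (m - k - 1)))
        - w * (real k * (- w) ^ (k - 1) * y ^ (m - k))
      = (real (m - k) + real k) * ((- w) ^ k * y ^ (m - k))"
      by (simp only: mult_minus_left mult_minus_right diff_minus_eq_add distrib_left distrib_right mult_ac)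
    then show ?thesis
      using that by (simp flip: of_nat_add)
  qed
  have "real m * jacobi_form n p q w y =
    y * (\<Sum>k\<le>m. ((real m + p) gchoose (m - k)) * ((real m + q) gchoose k)
        * ((- w) ^ k * (real (m - k) * y ^ (m - k - 1))))
    - w * (\<Sum>k\<le>m. ((real m + p) gchoose (m - k)) * ((real m + q) gchoose k)
        * (real k * (- w) ^ (k - 1) * y ^ (m - k)))"
    unfolding n jacobi_form_int sum_distrib_left sum_subtractf[symmetric]
  proof (intro sum.cong refl)
    fix k assume "k \<in> {..m}"
    then have "k \<le> m" by simp
    have "real m * (((real m + p) gchoose (m - k)) * ((real m + q) gchoose k) * (- w) ^ k * y ^ (m - k))
      = ((real m + p) gchoose (m - k)) * ((real m + q) gchoose k) * (real m * ((- w) ^ k * y ^ (m - k)))"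
      by (simp only: mult_ac)
    then show "real m * (((real m + p) gchoose (m - k)) * ((real m + q) gchoose k) * (- w) ^ k * y ^ (m - k))
      = y * (((real m + p) gchoose (m - k)) * ((real m + q) gchoose k) * ((- w) ^ k * (real (m - k) * y ^ (m - k - 1))))
      - w * (((real m + p) gchoose (m - k)) * ((real m + q) gchoose k) * (real k * (- w) ^ (k - 1) * y ^ (m - k)))"
      unfolding monomial[OF \<open>k \<le> m\<close>] by (simp only: right_diff_distrib mult_ac)
  qed
  then show ?thesis
    unfolding jacobi_form_termwise_dy jacobi_form_termwise_dw n by simp
qed simp

text \<open>
  The left-hand side is the derivative of the form in the direction that increases \<open>y\<close> and decreases \<open>w\<close>
  at the same rate; hence this is the homogeneous version of the formula for the derivative of a
  Jacobi polynomial. Pascal's relations express both summands by the form on the right and by two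
  forms of degree \<open>n - 2\<close>, and Euler's relation in degree \<open>n - 1\<close> evaluates what these contribute.
\<close>
lemma jacobi_form_lower_sum:
  "(of_int n + p) * jacobi_form (n - 1) p (q + 1) w y + (of_int n + q) * jacobi_form (n - 1) (p + 1) q w y
   = (of_int n + p + q + 1) * jacobi_form (n - 1) (p + 1) (q + 1) w y"
proof -
  have G: "jacobi_form (n - 1) (p + 1) (q + 1) w y = jacobi_form (n - 1) p (q + 1) w y
      + y * jacobi_form (n - 2) (p + 1) (q + 2) w y"
    using jacobi_form_pascal_left[of "n - 1" p "q + 1" w y] by (simp add: add.assoc)
  have F: "jacobi_form (n - 1) (p + 1) (q + 1) w y = jacobi_form (n - 1) (p + 1) q w y
      - w * jacobi_form (n - 2) (p + 2) (q + 1) w y"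
    using jacobi_form_pascal_right[of "n - 1" "p + 1" q w y] by (simp add: add.assoc)
  have E: "(of_int n - 1) * jacobi_form (n - 1) (p + 1) (q + 1) w y
     = y * (of_int n + p) * jacobi_form (n - 2) (p + 1) (q + 2) w y
     - w * (of_int n + q) * jacobi_form (n - 2) (p + 2) (q + 1) w y"
    using jacobi_form_euler[of "n - 1" "p + 1" "q + 1" w y] by (simp add: add.assoc)
  from G F have expand: "jacobi_form (n - 1) p (q + 1) w y
      = jacobi_form (n - 1) (p + 1) (q + 1) w y - y * jacobi_form (n - 2) (p + 1) (q + 2) w y"
    "jacobi_form (n - 1) (p + 1) q w y
      = jacobi_form (n - 1) (p + 1) (q + 1) w y + w * jacobi_form (n - 2) (p + 2) (q + 1) w y"
    by linarith+
  have "(m + p) * (C - y * U) + (m + q) * (C + w * V) = (m + p + q + 1) * C"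
    if "(m - 1) * C = y * (m + p) * U - w * (m + q) * V" for m C U V :: real
    using that by algebra
  from this[OF E] show ?thesis
    unfolding expand .
qed

text \<open>
  For \<open>w + y = 1\<close> this expresses the derivative of \<open>(1 - t) powr p\<close> times the Jacobi polynomial. The two
  Pascal relations combine to \<open>H(n; p - 1, q + 1) = H(n; p, q) - (w + y) H(n - 1; p, q + 1)\<close>.
\<close>
lemma jacobi_form_lower_left_parameter:
  "p * jacobi_form n p q w y =
   (of_int n + p) * jacobi_form n (p - 1) (q + 1) w y
   + (of_int n + p + q + 1) * w * jacobi_form (n - 1) (p + 1) (q + 1) w y"
proof -
  have degree: "jacobi_form n (p - 1) (q + 1) w y
      = jacobi_form n p q w y - (w + y) * jacobi_form (n - 1) p (q + 1) w y"
    using jacobi_form_pascal_left[of n "p - 1" q w y] jacobi_form_pascal_right[of n "p - 1" q w y]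
    by (simp add: distrib_right)
  have slope: "(of_int n + p + q + 1) * w * jacobi_form (n - 1) (p + 1) (q + 1) w y
      = w * ((of_int n + p) * jacobi_form (n - 1) p (q + 1) w y
          + (of_int n + q) * jacobi_form (n - 1) (p + 1) q w y)"
    unfolding jacobi_form_lower_sum by simp
  have "p * J = (m + p) * (J - (w + y) * A) + w * ((m + p) * A + (m + q) * B)"
    if "m * J = y * (m + p) * A - w * (m + q) * B" for m J A B :: real
    using that by algebra
  from this[OF jacobi_form_euler] show ?thesis
    unfolding degree slope .
qed

text \<open>
  Multiplying Pascal's relation by \<open>n + p + q + 1\<close> turns its second term into \<open>w\<close> times a directional
  derivative; Euler's relation expresses the \<open>w\<close>-part of it by the \<open>y\<close>-part and \<open>n\<close> times the form.
\<close>
lemma jacobi_form_raise_right_parameter: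
  "(2 * of_int n + p + q + 1) * jacobi_form n p q w y =
   (of_int n + p + q + 1) * jacobi_form n p (q + 1) w y
   + (of_int n + p) * (w + y) * jacobi_form (n - 1) p (q + 1) w y"
proof -
  have slope: "(of_int n + p + q + 1) * jacobi_form n p (q + 1) w y
      = (of_int n + p + q + 1) * jacobi_form n p q w y
        - w * ((of_int n + p) * jacobi_form (n - 1) p (q + 1) w y
          + (of_int n + q) * jacobi_form (n - 1) (p + 1) q w y)"
    unfolding jacobi_form_lower_sum jacobi_form_pascal_right[of n p q]
    by (simp only: right_diff_distrib mult_ac)
  have "(2 * m + p + q + 1) * J
      = ((m + p + q + 1) * J - w * ((m + p) * A + (m + q) * B)) + (m + p) * (w + y) * A"
    if "m * J = y * (m + p) * A - w * (m + q) * B" for m J A B :: real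
    using that by algebra
  from this[OF jacobi_form_euler] show ?thesis
    unfolding slope .
qed

section \<open>Rodrigues' formula\<close>

text \<open>
  The right-hand side appears when \<open>w powr p * y powr q * H(n; p, q)(w, y)\<close> is differentiated along
  \<open>w = 1 - t\<close>, \<open>y = 1 + t\<close>: up to the sign it is what remains after \<open>w powr (p - 1) * y powr (q - 1)\<close> has
  been factored out. Euler's relation in degree \<open>n + 1\<close> reduces the left-hand side to forms of degree
  \<open>n\<close>, and Pascal's relations bring these to the parameters \<open>p, q\<close>.
\<close>
lemma jacobi_form_rodrigues_step:
  "(of_int n + 1) * jacobi_form (n + 1) (p - 1) (q - 1) w y =
   (p * y - q * w) * jacobi_form n p q w y
   - w * y * (of_int n + p + q + 1) * jacobi_form (n - 1) (p + 1) (q + 1) w y"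
proof -
  define A B where "A = jacobi_form (n - 1) p (q + 1) w y" and "B = jacobi_form (n - 1) (p + 1) q w y"
  have "jacobi_form n (p - 1) q w y = jacobi_form n p q w y - y * A"
    and "jacobi_form n p (q - 1) w y = jacobi_form n p q w y + w * B"
    using jacobi_form_pascal_left[of n "p - 1" q w y] jacobi_form_pascal_right[of n p "q - 1" w y]
    by (simp_all add: A_def B_def)
  moreover have "(of_int n + 1) * jacobi_form (n + 1) (p - 1) (q - 1) w y
      = y * (of_int n + p) * jacobi_form n (p - 1) q w y
        - w * (of_int n + q) * jacobi_form n p (q - 1) w y"
  proof -
    have "of_int (n + 1) + (p - 1) = of_int n + p" "of_int (n + 1) + (q - 1) = of_int n + q"
      "of_int (n + 1) = of_int n + (1 :: real)"
      by simp_all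
    with jacobi_form_euler[of "n + 1" "p - 1" "q - 1" w y] show ?thesis
      by (simp only: diff_add_cancel add_diff_cancel_right')
  qed
  ultimately have raised: "(of_int n + 1) * jacobi_form (n + 1) (p - 1) (q - 1) w y
      = y * (of_int n + p) * (jacobi_form n p q w y - y * A)
        - w * (of_int n + q) * (jacobi_form n p q w y + w * B)"
    by simp
  have slope: "w * y * (of_int n + p + q + 1) * jacobi_form (n - 1) (p + 1) (q + 1) w y
      = w * y * ((of_int n + p) * A + (of_int n + q) * B)"
    unfolding A_def B_def jacobi_form_lower_sum by simp
  have "y * (m + p) * (J - y * A) - w * (m + q) * (J + w * B)
      = (p * y - q * w) * J - w * y * ((m + p) * A + (m + q) * B)"
    if "m * J = y * (m + p) * A - w * (m + q) * B" for m J A B :: real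
    using that by algebra
  from this[OF jacobi_form_euler[of n p q w y, folded A_def B_def]] show ?thesis
    unfolding raised slope .
qed

text \<open>
  Induction on the number of derivatives with the exponents \<open>a, b\<close> fixed: each derivative lowers both
  parameters of the form by one and raises its degree by one. The induction hypothesis may be
  differentiated because it holds on a whole neighbourhood of \<open>t\<close>.
\<close>
lemma higher_deriv_weight:
  assumes "- 1 < t" "t < 1"
  shows "(deriv ^^ n) (\<lambda>s. (1 - s) powr a * (1 + s) powr b) t =
    (- 1) ^ n * fact n * (1 - t) powr (a - real n) * (1 + t) powr (b - real n)
      * jacobi_form (int n) (a - real n) (b - real n) (1 - t) (1 + t)"
  using assms
proof (induction n arbitrary: t)
  case (Suc n)
  define p q where "p = a - real n" and "q = b - real n"
  define H where "H m p q = jacobi_form m p q (1 - t) (1 + t)" for m p q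
  define g where "g s = (- 1) ^ n * fact n * ((1 - s) powr p * (1 + s) powr q
      * jacobi_form (int n) p q (1 - s) (1 + s))" for s :: real
  have powr: "1 - t > 0" "1 + t > 0"
    using Suc.prems by auto
  have dform: "((\<lambda>s. jacobi_form (int n) p q (1 - s) (1 + s)) has_real_derivative
      (real n + p + q + 1) * H (int n - 1) (p + 1) (q + 1)) (at t)"
  proof -
    have "((\<lambda>s. 1 - s) has_real_derivative - 1) (at t)" "((\<lambda>s. 1 + s) has_real_derivative 1) (at t)"
      by (auto intro!: derivative_eq_intros)
    from jacobi_form_deriv[OF this, of "int n" p q] show ?thesis
      using jacobi_form_lower_sum[of "int n" p q "1 - t" "1 + t"] by (simp add: H_def)
  qed
  have dw: "((\<lambda>s. (1 - s) powr p) has_real_derivative - p * (1 - t) powr (p - 1)) (at t)"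
    and dy: "((\<lambda>s. (1 + s) powr q) has_real_derivative q * (1 + t) powr (q - 1)) (at t)"
    using powr by (auto intro!: derivative_eq_intros simp: powr_diff)
  have w: "(1 - t) powr p = (1 - t) * (1 - t) powr (p - 1)"
    and y: "(1 + t) powr q = (1 + t) * (1 + t) powr (q - 1)"
    using powr by (simp_all add: powr_diff)
  have factor: "e * ((W * P * (q * Q) + (- p * P) * (Y * Q)) * h + W * P * (Y * Q) * (r * k))
      = e * P * Q * (- ((p * Y - q * W) * h - W * Y * r * k))" for e W P Y Q h r k :: real
    by algebra
  have step: "(p * (1 + t) - q * (1 - t)) * H (int n) p q
       - (1 - t) * (1 + t) * (real n + p + q + 1) * H (int n - 1) (p + 1) (q + 1)
      = (real n + 1) * H (int n + 1) (p - 1) (q - 1)"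
    using jacobi_form_rodrigues_step[of "int n" p q "1 - t" "1 + t"] by (simp only: H_def of_int_of_nat_eq)
  have "(g has_real_derivative (- 1) ^ n * fact n *
     (((1 - t) powr p * (q * (1 + t) powr (q - 1)) + (- p * (1 - t) powr (p - 1)) * (1 + t) powr q)
        * H (int n) p q
      + (1 - t) powr p * (1 + t) powr q * ((real n + p + q + 1) * H (int n - 1) (p + 1) (q + 1)))) (at t)"
    unfolding g_def using DERIV_cmult[OF DERIV_mult[OF DERIV_mult[OF dw dy] dform], of "(- 1) ^ n * fact n"]
    by (simp only: H_def add_ac mult_ac)
  then have "deriv g t = (- 1) ^ n * fact n *
     (((1 - t) powr p * (q * (1 + t) powr (q - 1)) + (- p * (1 - t) powr (p - 1)) * (1 + t) powr q)
        * H (int n) p q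
      + (1 - t) powr p * (1 + t) powr q * ((real n + p + q + 1) * H (int n - 1) (p + 1) (q + 1)))"
    by (rule DERIV_imp_deriv)
  also have "\<dots> = (- 1) ^ n * fact n * (1 - t) powr (p - 1) * (1 + t) powr (q - 1)
     * (- ((p * (1 + t) - q * (1 - t)) * H (int n) p q
       - (1 - t) * (1 + t) * (real n + p + q + 1) * H (int n - 1) (p + 1) (q + 1)))"
    unfolding w y by (rule factor)
  also have "\<dots> = (- 1) ^ Suc n * fact (Suc n) * (1 - t) powr (p - 1) * (1 + t) powr (q - 1)
     * H (int n + 1) (p - 1) (q - 1)"
    unfolding step by (simp add: mult_ac add_ac)
  finally have dg: "deriv g t = (- 1) ^ Suc n * fact (Suc n) * (1 - t) powr (p - 1) * (1 + t) powr (q - 1)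
     * H (int n + 1) (p - 1) (q - 1)" .
  have "\<forall>\<^sub>F s in nhds t. s \<in> {- 1<..<1}"
    using Suc.prems by (intro eventually_nhds_in_open) auto
  then have "\<forall>\<^sub>F s in nhds t. (deriv ^^ n) (\<lambda>s. (1 - s) powr a * (1 + s) powr b) s = g s"
    by eventually_elim (simp add: Suc.IH g_def p_def q_def mult_ac)
  then have "(deriv ^^ Suc n) (\<lambda>s. (1 - s) powr a * (1 + s) powr b) t = deriv g t"
    by (simp add: deriv_cong_ev)
  then show ?case
    unfolding dg by (simp add: H_def p_def q_def algebra_simps)
qed simp

lemma jacobi_eq_form:
  assumes "- 1 < t" "t < 1"
  shows "jacobi n p q t = jacobi_form (int n) p q ((1 - t) / 2) ((1 + t) / 2)"
proof -
  have deriv: "(deriv ^^ n) (\<lambda>s. (1 - s) powr (real n + p) * (1 + s) powr (real n + q)) t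
      = (- 1) ^ n * fact n * (1 - t) powr p * (1 + t) powr q * jacobi_form (int n) p q (1 - t) (1 + t)"
    using higher_deriv_weight[OF assms, of n "real n + p" "real n + q"] by simp
  have "jacobi n p q t = jacobi_form (int n) p q (1 - t) (1 + t) / 2 ^ n"
    unfolding jacobi_def deriv powr_minus using assms by (simp add: field_simps flip: power_mult_distrib)
  then show ?thesis
    using jacobi_form_homogeneous[of n p q "1/2" "1 - t" "1 + t"] by (simp add: power_divide)
qed

text \<open>
  For \<open>c = 1\<close>, \<open>c = 1 - x\<close> and \<open>c = 1 - x - y\<close> these are the three factors of a Koornwinder polynomial.
\<close>
lemma scaled_jacobi_eq_form:
  assumes "0 < y" "y < c"
  shows "c ^ n * jacobi n p q (2 * y / c - 1) = jacobi_form (int n) p q (c - y) y"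
proof -
  have "(1 - (2 * y / c - 1)) / 2 = (c - y) / c" "(1 + (2 * y / c - 1)) / 2 = y / c"
    using assms by (simp_all add: field_simps)
  moreover have "- 1 < 2 * y / c - 1" "2 * y / c - 1 < 1"
    using assms by (simp_all add: field_simps)
  ultimately have "jacobi n p q (2 * y / c - 1) = jacobi_form (int n) p q ((c - y) / c) (y / c)"
    by (simp only: jacobi_eq_form)
  then show ?thesis
    using assms jacobi_form_homogeneous[of n p q c "(c - y) / c" "y / c"] by simp
qed

section \<open>Koornwinder polynomials as products of forms\<close>

text \<open>
  This polynomial agrees with \<open>koornwinder\<close> on the simplex and is defined everywhere, so the
  relations can be proved for it at every point and for all integer indices.
\<close>
definition koornwinder_form ::
  "real \<Rightarrow> real \<Rightarrow> real \<Rightarrow> real \<Rightarrow> int \<Rightarrow> int \<Rightarrow> int \<Rightarrow> real \<Rightarrow> real \<Rightarrow> real \<Rightarrow> real" where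
  "koornwinder_form \<alpha> \<beta> \<gamma> \<delta> n1 n2 n3 x y z =
     jacobi_form n1 (\<beta> + \<gamma> + \<delta> + 2 * of_int n2 + 2 * of_int n3 + 2) \<alpha> (1 - x) x *
     jacobi_form n2 (\<gamma> + \<delta> + 2 * of_int n3 + 1) \<beta> (1 - x - y) y *
     jacobi_form n3 \<delta> \<gamma> (1 - x - y - z) z"

lemma koornwinder_eq_form:
  assumes "(x, y, z) \<in> simplex3"
  shows "koornwinder \<alpha> \<beta> \<gamma> \<delta> n1 n2 n3 x y z = koornwinder_form \<alpha> \<beta> \<gamma> \<delta> n1 n2 n3 x y z"
proof (cases "n1 < 0 \<or> n2 < 0 \<or> n3 < 0")
  case True
  then show ?thesis
    by (auto simp: koornwinder_def koornwinder_form_def)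
next
  case False
  then have pos: "n1 \<ge> 0" "n2 \<ge> 0" "n3 \<ge> 0"
    by auto
  have s: "0 < x" "0 < y" "0 < z" "x < 1" "y < 1 - x" "z < 1 - x - y"
    using assms by (auto simp: simplex3_def)
  show ?thesis
    using False scaled_jacobi_eq_form[OF s(1,4), of "nat n1"] scaled_jacobi_eq_form[OF s(2,5), of "nat n2"]
      scaled_jacobi_eq_form[OF s(3,6), of "nat n3"] pos
    unfolding koornwinder_def koornwinder_form_def by (simp add: mult.assoc)
qed

lemma jacobi_form_deriv_diagonal: "((\<lambda>s. jacobi_form n p q (c - s) s) has_real_derivative
   (of_int n + p + q + 1) * jacobi_form (n - 1) (p + 1) (q + 1) (c - x) x) (at x)"
proof -
  have "((\<lambda>s. c - s) has_real_derivative - 1) (at x)" "((\<lambda>s. s) has_real_derivative 1) (at x)"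
    by (auto intro!: derivative_eq_intros)
  from jacobi_form_deriv[OF this, of n p q] show ?thesis
    using jacobi_form_lower_sum[of n p q "c - x" x] by simp
qed

lemma jacobi_form_deriv_left:
  assumes "(w has_real_derivative - 1) (at s)"
  shows "((\<lambda>s. jacobi_form n p q (w s) y) has_real_derivative
     (of_int n + q) * jacobi_form (n - 1) (p + 1) q (w s) y) (at s)"
  using jacobi_form_deriv[OF assms DERIV_const, of n p q y] by simp

text \<open>
  The parameters \<open>a\<close> and \<open>b\<close> are variables constrained by equations so that Koornwinder polynomials
  with shifted indices and parameters can be expressed by the \<open>a\<close> and \<open>b\<close> of the original one.
\<close>
lemma koornwinder_form_expand:
  assumes "a = \<beta> + \<gamma> + \<delta> + 2 * of_int n2 + 2 * of_int n3 + 2"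
    and "b = \<gamma> + \<delta> + 2 * of_int n3 + 1"
  shows "koornwinder_form \<alpha> \<beta> \<gamma> \<delta> n1 n2 n3 x y z =
     jacobi_form n1 a \<alpha> (1 - x) x * jacobi_form n2 b \<beta> (1 - x - y) y
       * jacobi_form n3 \<delta> \<gamma> (1 - x - y - z) z"
  by (simp add: koornwinder_form_def assms)

section \<open>The differential relations\<close>

lemma partial_x_koornwinder_form:
  assumes "a = \<beta> + \<gamma> + \<delta> + 2 * of_int n2 + 2 * of_int n3 + 2"
    and "b = \<gamma> + \<delta> + 2 * of_int n3 + 1"
  shows "partial_x (koornwinder_form \<alpha> \<beta> \<gamma> \<delta> n1 n2 n3) x y z =
     (of_int n1 + a + \<alpha> + 1) * jacobi_form (n1 - 1) (a + 1) (\<alpha> + 1) (1 - x) x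
       * jacobi_form n2 b \<beta> (1 - x - y) y * jacobi_form n3 \<delta> \<gamma> (1 - x - y - z) z
     + jacobi_form n1 a \<alpha> (1 - x) x
       * ((of_int n2 + \<beta>) * jacobi_form (n2 - 1) (b + 1) \<beta> (1 - x - y) y)
       * jacobi_form n3 \<delta> \<gamma> (1 - x - y - z) z
     + jacobi_form n1 a \<alpha> (1 - x) x * jacobi_form n2 b \<beta> (1 - x - y) y
       * ((of_int n3 + \<gamma>) * jacobi_form (n3 - 1) (\<delta> + 1) \<gamma> (1 - x - y - z) z)"
proof -
  have "((\<lambda>s. 1 - s - y) has_real_derivative - 1) (at x)"
    and "((\<lambda>s. 1 - s - y - z) has_real_derivative - 1) (at x)"
    by (auto intro!: derivative_eq_intros)
  note d = this[THEN jacobi_form_deriv_left]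
  show ?thesis
    unfolding partial_x_def koornwinder_form_expand[OF assms]
    by (rule DERIV_imp_deriv, rule DERIV_cong,
        rule DERIV_mult[OF DERIV_mult[OF jacobi_form_deriv_diagonal d(1)] d(2)])
      (simp only: distrib_left distrib_right mult_ac)
qed

lemma partial_y_koornwinder_form:
  assumes "a = \<beta> + \<gamma> + \<delta> + 2 * of_int n2 + 2 * of_int n3 + 2"
    and "b = \<gamma> + \<delta> + 2 * of_int n3 + 1"
  shows "partial_y (koornwinder_form \<alpha> \<beta> \<gamma> \<delta> n1 n2 n3) x y z =
     jacobi_form n1 a \<alpha> (1 - x) x
       * ((of_int n2 + b + \<beta> + 1) * jacobi_form (n2 - 1) (b + 1) (\<beta> + 1) (1 - x - y) y)
       * jacobi_form n3 \<delta> \<gamma> (1 - x - y - z) z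
     + jacobi_form n1 a \<alpha> (1 - x) x * jacobi_form n2 b \<beta> (1 - x - y) y
       * ((of_int n3 + \<gamma>) * jacobi_form (n3 - 1) (\<delta> + 1) \<gamma> (1 - x - y - z) z)"
proof -
  have "((\<lambda>s. 1 - x - s - z) has_real_derivative - 1) (at y)"
    by (auto intro!: derivative_eq_intros)
  note d = this[THEN jacobi_form_deriv_left]
  show ?thesis
    unfolding partial_y_def koornwinder_form_expand[OF assms]
    by (rule DERIV_imp_deriv, rule DERIV_cong,
        rule DERIV_mult[OF DERIV_cmult[OF jacobi_form_deriv_diagonal] d])
      (simp only: mult_ac)
qed

lemma koornwinder_form_partial_z:
  "partial_z (koornwinder_form \<alpha> \<beta> \<gamma> \<delta> n1 n2 n3) x y z =
     (of_int n3 + \<gamma> + \<delta> + 1) * koornwinder_form \<alpha> \<beta> (\<gamma> + 1) (\<delta> + 1) n1 n2 (n3 - 1) x y z"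
proof -
  define a b where "a = \<beta> + \<gamma> + \<delta> + 2 * of_int n2 + 2 * of_int n3 + 2"
    and "b = \<gamma> + \<delta> + 2 * of_int n3 + 1"
  have "koornwinder_form \<alpha> \<beta> (\<gamma> + 1) (\<delta> + 1) n1 n2 (n3 - 1) x y z =
     jacobi_form n1 a \<alpha> (1 - x) x * jacobi_form n2 b \<beta> (1 - x - y) y
       * jacobi_form (n3 - 1) (\<delta> + 1) (\<gamma> + 1) (1 - x - y - z) z"
    by (rule koornwinder_form_expand) (simp_all add: a_def b_def)
  then show ?thesis
    unfolding partial_z_def koornwinder_form_expand[OF a_def b_def]
    by (intro DERIV_imp_deriv, intro DERIV_cong[OF DERIV_cmult[OF jacobi_form_deriv_diagonal]])
      (simp only: mult_ac add_ac)
qed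

text \<open>
  The third factor depends on \<open>x\<close> and \<open>y\<close> only through \<open>x + y\<close>, so its derivatives cancel; for the second
  factor the difference leaves only the derivative in its second argument.
\<close>
lemma partial_x_minus_y_koornwinder_form:
  assumes "a = \<beta> + \<gamma> + \<delta> + 2 * of_int n2 + 2 * of_int n3 + 2"
    and "b = \<gamma> + \<delta> + 2 * of_int n3 + 1"
  shows "partial_x (koornwinder_form \<alpha> \<beta> \<gamma> \<delta> n1 n2 n3) x y z
     - partial_y (koornwinder_form \<alpha> \<beta> \<gamma> \<delta> n1 n2 n3) x y z =
     ((of_int n1 + a + \<alpha> + 1) * jacobi_form (n1 - 1) (a + 1) (\<alpha> + 1) (1 - x) x
         * jacobi_form n2 b \<beta> (1 - x - y) y
       - (of_int n2 + b) * jacobi_form n1 a \<alpha> (1 - x) x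
         * jacobi_form (n2 - 1) b (\<beta> + 1) (1 - x - y) y)
     * jacobi_form n3 \<delta> \<gamma> (1 - x - y - z) z"
  unfolding partial_x_koornwinder_form[OF assms] partial_y_koornwinder_form[OF assms]
    jacobi_form_lower_sum[of n2, symmetric]
  by (simp only: distrib_left distrib_right left_diff_distrib right_diff_distrib mult_ac)

text \<open>
  Multiplied by \<open>a\<close>, the second factor of the first product and the first factor of the second product
  can be rewritten by the contiguity relations. Both yield a multiple of
  \<open>(1 - x) H(n1 - 1; a + 1, \<alpha> + 1) H(n2 - 1; b, \<beta> + 1)\<close>, and these two terms cancel.
\<close>
lemma koornwinder_xy_factors_identity:
  assumes "a = 2 * of_int n2 + b + \<beta> + 1"
  shows "a * ((of_int n1 + a + \<alpha> + 1) * jacobi_form (n1 - 1) (a + 1) (\<alpha> + 1) (1 - x) x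
         * jacobi_form n2 b \<beta> (1 - x - y) y
       - (of_int n2 + b) * jacobi_form n1 a \<alpha> (1 - x) x
         * jacobi_form (n2 - 1) b (\<beta> + 1) (1 - x - y) y) =
    (of_int n2 + b + \<beta> + 1) * (of_int n1 + a + \<alpha> + 1)
        * (jacobi_form (n1 - 1) (a + 1) (\<alpha> + 1) (1 - x) x * jacobi_form n2 b (\<beta> + 1) (1 - x - y) y)
    - (of_int n1 + a) * (of_int n2 + b)
        * (jacobi_form n1 (a - 1) (\<alpha> + 1) (1 - x) x * jacobi_form (n2 - 1) b (\<beta> + 1) (1 - x - y) y)"
proof -
  have C: "a * jacobi_form n2 b \<beta> (1 - x - y) y =
      (of_int n2 + b + \<beta> + 1) * jacobi_form n2 b (\<beta> + 1) (1 - x - y) y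
      + (of_int n2 + b) * (1 - x) * jacobi_form (n2 - 1) b (\<beta> + 1) (1 - x - y) y"
    using jacobi_form_raise_right_parameter[of n2 b \<beta> "1 - x - y" y] by (simp add: assms)
  have B: "a * jacobi_form n1 a \<alpha> (1 - x) x =
      (of_int n1 + a) * jacobi_form n1 (a - 1) (\<alpha> + 1) (1 - x) x
      + (of_int n1 + a + \<alpha> + 1) * (1 - x) * jacobi_form (n1 - 1) (a + 1) (\<alpha> + 1) (1 - x) x"
    by (rule jacobi_form_lower_left_parameter)
  have "a * ((of_int n1 + a + \<alpha> + 1) * jacobi_form (n1 - 1) (a + 1) (\<alpha> + 1) (1 - x) x
         * jacobi_form n2 b \<beta> (1 - x - y) y
       - (of_int n2 + b) * jacobi_form n1 a \<alpha> (1 - x) x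
         * jacobi_form (n2 - 1) b (\<beta> + 1) (1 - x - y) y) =
       (of_int n1 + a + \<alpha> + 1) * jacobi_form (n1 - 1) (a + 1) (\<alpha> + 1) (1 - x) x
         * (a * jacobi_form n2 b \<beta> (1 - x - y) y)
       - (of_int n2 + b) * (a * jacobi_form n1 a \<alpha> (1 - x) x)
         * jacobi_form (n2 - 1) b (\<beta> + 1) (1 - x - y) y"
    by (simp only: right_diff_distrib mult_ac)
  also have "\<dots> = (of_int n2 + b + \<beta> + 1) * (of_int n1 + a + \<alpha> + 1)
        * (jacobi_form (n1 - 1) (a + 1) (\<alpha> + 1) (1 - x) x * jacobi_form n2 b (\<beta> + 1) (1 - x - y) y)
    - (of_int n1 + a) * (of_int n2 + b)
        * (jacobi_form n1 (a - 1) (\<alpha> + 1) (1 - x) x * jacobi_form (n2 - 1) b (\<beta> + 1) (1 - x - y) y)"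
    unfolding B C by (simp only: distrib_left distrib_right mult_ac)
  finally show ?thesis .
qed

lemma koornwinder_form_x_minus_y:
  "(2 * of_int n2 + 2 * of_int n3 + \<beta> + \<gamma> + \<delta> + 2) *
     (partial_x (koornwinder_form \<alpha> \<beta> \<gamma> \<delta> n1 n2 n3) x y z
      - partial_y (koornwinder_form \<alpha> \<beta> \<gamma> \<delta> n1 n2 n3) x y z)
   = (of_int n2 + 2 * of_int n3 + \<beta> + \<gamma> + \<delta> + 2) *
       (of_int n1 + 2 * of_int n2 + 2 * of_int n3 + \<alpha> + \<beta> + \<gamma> + \<delta> + 3) *
       koornwinder_form (\<alpha> + 1) (\<beta> + 1) \<gamma> \<delta> (n1 - 1) n2 n3 x y z
     - (of_int n1 + 2 * of_int n2 + 2 * of_int n3 + \<beta> + \<gamma> + \<delta> + 2) *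
       (of_int n2 + 2 * of_int n3 + \<gamma> + \<delta> + 1) *
       koornwinder_form (\<alpha> + 1) (\<beta> + 1) \<gamma> \<delta> n1 (n2 - 1) n3 x y z"
proof -
  define a b where "a = \<beta> + \<gamma> + \<delta> + 2 * of_int n2 + 2 * of_int n3 + 2"
    and "b = \<gamma> + \<delta> + 2 * of_int n3 + 1"
  have c: "2 * of_int n2 + 2 * of_int n3 + \<beta> + \<gamma> + \<delta> + 2 = a"
    "of_int n2 + 2 * of_int n3 + \<beta> + \<gamma> + \<delta> + 2 = of_int n2 + b + \<beta> + 1"
    "of_int n1 + 2 * of_int n2 + 2 * of_int n3 + \<alpha> + \<beta> + \<gamma> + \<delta> + 3 = of_int n1 + a + \<alpha> + 1"
    "of_int n1 + 2 * of_int n2 + 2 * of_int n3 + \<beta> + \<gamma> + \<delta> + 2 = of_int n1 + a"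
    "of_int n2 + 2 * of_int n3 + \<gamma> + \<delta> + 1 = of_int n2 + b"
    by (simp_all add: a_def b_def)
  have K1: "koornwinder_form (\<alpha> + 1) (\<beta> + 1) \<gamma> \<delta> (n1 - 1) n2 n3 x y z =
      jacobi_form (n1 - 1) (a + 1) (\<alpha> + 1) (1 - x) x * jacobi_form n2 b (\<beta> + 1) (1 - x - y) y
        * jacobi_form n3 \<delta> \<gamma> (1 - x - y - z) z"
    by (rule koornwinder_form_expand) (simp_all add: a_def b_def)
  have K2: "koornwinder_form (\<alpha> + 1) (\<beta> + 1) \<gamma> \<delta> n1 (n2 - 1) n3 x y z =
      jacobi_form n1 (a - 1) (\<alpha> + 1) (1 - x) x * jacobi_form (n2 - 1) b (\<beta> + 1) (1 - x - y) y
        * jacobi_form n3 \<delta> \<gamma> (1 - x - y - z) z"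
    by (rule koornwinder_form_expand) (simp_all add: a_def b_def)
  have a: "a = 2 * of_int n2 + b + \<beta> + 1"
    by (simp add: a_def b_def)
  have "a * (e * h) = k * (u * h) - l * (v * h)" if "a * e = k * u - l * v" for e h k l u v
    using that by algebra
  from this[OF koornwinder_xy_factors_identity[OF a]] show ?thesis
    unfolding c K1 K2 partial_x_minus_y_koornwinder_form[OF a_def b_def] .
qed

text \<open>
  Here the first form is constant, and in the third one only the second argument varies. The same cancellation
  as for \<open>d/dx - d/dy\<close> takes place one level further down: the second and third forms have the roles of the
  first and second one, \<open>b\<close> that of \<open>a\<close>, and \<open>1 - x - y\<close> that of \<open>1 - x\<close>.
\<close>
lemma koornwinder_form_z_minus_y:
  "(2 * of_int n3 + \<gamma> + \<delta> + 1) *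
     (partial_z (koornwinder_form \<alpha> \<beta> \<gamma> \<delta> n1 n2 n3) x y z
      - partial_y (koornwinder_form \<alpha> \<beta> \<gamma> \<delta> n1 n2 n3) x y z)
   = (of_int n3 + \<delta>) * (of_int n2 + 2 * of_int n3 + \<gamma> + \<delta> + 1) *
       koornwinder_form \<alpha> (\<beta> + 1) (\<gamma> + 1) \<delta> n1 n2 (n3 - 1) x y z
     - (of_int n2 + 2 * of_int n3 + \<beta> + \<gamma> + \<delta> + 2) * (of_int n3 + \<gamma> + \<delta> + 1) *
       koornwinder_form \<alpha> (\<beta> + 1) (\<gamma> + 1) \<delta> n1 (n2 - 1) n3 x y z"
proof -
  define a b where "a = \<beta> + \<gamma> + \<delta> + 2 * of_int n2 + 2 * of_int n3 + 2"
    and "b = \<gamma> + \<delta> + 2 * of_int n3 + 1"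
  define F where "F = jacobi_form n1 a \<alpha> (1 - x) x"
  define G where "G m p q = jacobi_form m p q (1 - x - y) y" for m p q
  define H where "H m p q = jacobi_form m p q (1 - x - y - z) z" for m p q
  have c: "2 * of_int n3 + \<gamma> + \<delta> + 1 = b"
    "of_int n2 + 2 * of_int n3 + \<beta> + \<gamma> + \<delta> + 2 = of_int n2 + b + \<beta> + 1"
    "of_int n2 + 2 * of_int n3 + \<gamma> + \<delta> + 1 = of_int n2 + b"
    by (simp_all add: a_def b_def)
  have K1: "koornwinder_form \<alpha> (\<beta> + 1) (\<gamma> + 1) \<delta> n1 n2 (n3 - 1) x y z =
      F * G n2 (b - 1) (\<beta> + 1) * H (n3 - 1) \<delta> (\<gamma> + 1)"
    unfolding F_def G_def H_def by (rule koornwinder_form_expand) (simp_all add: a_def b_def)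
  have K2: "koornwinder_form \<alpha> (\<beta> + 1) (\<gamma> + 1) \<delta> n1 (n2 - 1) n3 x y z =
      F * G (n2 - 1) (b + 1) (\<beta> + 1) * H n3 \<delta> (\<gamma> + 1)"
    unfolding F_def G_def H_def by (rule koornwinder_form_expand) (simp_all add: a_def b_def)
  have K3: "koornwinder_form \<alpha> \<beta> (\<gamma> + 1) (\<delta> + 1) n1 n2 (n3 - 1) x y z =
      F * G n2 b \<beta> * H (n3 - 1) (\<delta> + 1) (\<gamma> + 1)"
    unfolding F_def G_def H_def by (rule koornwinder_form_expand) (simp_all add: a_def b_def)
  \<comment> \<open>Splits the \<open>z\<close>-derivative of the third form, so that the part shared with the \<open>y\<close>-derivative cancels.\<close>
  have A: "(of_int n3 + \<gamma> + \<delta> + 1) * H (n3 - 1) (\<delta> + 1) (\<gamma> + 1)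
      = (of_int n3 + \<delta>) * H (n3 - 1) \<delta> (\<gamma> + 1) + (of_int n3 + \<gamma>) * H (n3 - 1) (\<delta> + 1) \<gamma>"
    using jacobi_form_lower_sum[of n3 \<delta> \<gamma> "1 - x - y - z" z] by (simp add: H_def add_ac)
  have B: "b * G n2 b \<beta> = (of_int n2 + b) * G n2 (b - 1) (\<beta> + 1)
      + (of_int n2 + b + \<beta> + 1) * (1 - x - y) * G (n2 - 1) (b + 1) (\<beta> + 1)"
    unfolding G_def by (rule jacobi_form_lower_left_parameter)
  have C: "b * H n3 \<delta> \<gamma> = (of_int n3 + \<gamma> + \<delta> + 1) * H n3 \<delta> (\<gamma> + 1)
      + (of_int n3 + \<delta>) * (1 - x - y) * H (n3 - 1) \<delta> (\<gamma> + 1)"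
    using jacobi_form_raise_right_parameter[of n3 \<delta> \<gamma> "1 - x - y - z" z] by (simp add: b_def H_def add_ac)
  have eliminate: "f * ((k * g + l * w * g') * (d * h) - l * g' * (e * h' + d * w * h))
      = d * k * (f * g * h) - l * e * (f * g' * h')" for f k g l w g' d h e h' :: real
    by algebra
  have "b * (partial_z (koornwinder_form \<alpha> \<beta> \<gamma> \<delta> n1 n2 n3) x y z
      - partial_y (koornwinder_form \<alpha> \<beta> \<gamma> \<delta> n1 n2 n3) x y z)
    = b * (F * G n2 b \<beta> * ((of_int n3 + \<gamma> + \<delta> + 1) * H (n3 - 1) (\<delta> + 1) (\<gamma> + 1))
       - F * ((of_int n2 + b + \<beta> + 1) * G (n2 - 1) (b + 1) (\<beta> + 1)) * H n3 \<delta> \<gamma>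
       - F * G n2 b \<beta> * ((of_int n3 + \<gamma>) * H (n3 - 1) (\<delta> + 1) \<gamma>))"
    unfolding koornwinder_form_partial_z K3 partial_y_koornwinder_form[OF a_def b_def]
    by (simp add: F_def G_def H_def)
  also have "\<dots> = F * ((b * G n2 b \<beta>) * ((of_int n3 + \<delta>) * H (n3 - 1) \<delta> (\<gamma> + 1))
       - (of_int n2 + b + \<beta> + 1) * G (n2 - 1) (b + 1) (\<beta> + 1) * (b * H n3 \<delta> \<gamma>))"
    unfolding A by (simp only: distrib_left distrib_right left_diff_distrib right_diff_distrib mult_ac)
  also have "\<dots> = (of_int n3 + \<delta>) * (of_int n2 + b) * (F * G n2 (b - 1) (\<beta> + 1) * H (n3 - 1) \<delta> (\<gamma> + 1))
     - (of_int n2 + b + \<beta> + 1) * (of_int n3 + \<gamma> + \<delta> + 1)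
       * (F * G (n2 - 1) (b + 1) (\<beta> + 1) * H n3 \<delta> (\<gamma> + 1))"
    unfolding B C by (rule eliminate)
  finally show ?thesis
    unfolding c K1 K2 .
qed

text \<open>
  The \<open>z\<close>-derivative of \<open>koornwinder_form_x_minus_y\<close>, whose right-hand side is differentiated
  by \<open>koornwinder_form_partial_z\<close>. Differentiating the product, rather than dividing by the
  constant factor on the left, also covers the case that this factor is 0.
\<close>
lemma koornwinder_form_z_x_minus_y:
  "(2 * of_int n2 + 2 * of_int n3 + \<beta> + \<gamma> + \<delta> + 2) *
     partial_z (\<lambda>x y z. partial_x (koornwinder_form \<alpha> \<beta> \<gamma> \<delta> n1 n2 n3) x y z
      - partial_y (koornwinder_form \<alpha> \<beta> \<gamma> \<delta> n1 n2 n3) x y z) x y z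
   = (of_int n2 + 2 * of_int n3 + \<beta> + \<gamma> + \<delta> + 2) *
       (of_int n1 + 2 * of_int n2 + 2 * of_int n3 + \<alpha> + \<beta> + \<gamma> + \<delta> + 3) *
       (of_int n3 + \<gamma> + \<delta> + 1) *
       koornwinder_form (\<alpha> + 1) (\<beta> + 1) (\<gamma> + 1) (\<delta> + 1) (n1 - 1) n2 (n3 - 1) x y z
     - (of_int n1 + 2 * of_int n2 + 2 * of_int n3 + \<beta> + \<gamma> + \<delta> + 2) *
       (of_int n2 + 2 * of_int n3 + \<gamma> + \<delta> + 1) *
       (of_int n3 + \<gamma> + \<delta> + 1) *
       koornwinder_form (\<alpha> + 1) (\<beta> + 1) (\<gamma> + 1) (\<delta> + 1) n1 (n2 - 1) (n3 - 1) x y z"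
    (is "?c * partial_z ?D x y z = ?A * ?k * ?K1 - ?B * ?k * ?K2")
proof -
  define K where "K m1 m2 s = koornwinder_form (\<alpha> + 1) (\<beta> + 1) \<gamma> \<delta> m1 m2 n3 x y s" for m1 m2 s
  have dK: "(K m1 m2 has_real_derivative
      ?k * koornwinder_form (\<alpha> + 1) (\<beta> + 1) (\<gamma> + 1) (\<delta> + 1) m1 m2 (n3 - 1) x y z) (at z)" for m1 m2
  proof -
    have "K m1 m2 field_differentiable at z"
      unfolding K_def koornwinder_form_def
      unfolding field_differentiable_def by (rule exI, rule DERIV_cmult[OF jacobi_form_deriv_diagonal])
    from DERIV_deriv_iff_field_differentiable[THEN iffD2, OF this] show ?thesis
      using koornwinder_form_partial_z[of "\<alpha> + 1" "\<beta> + 1" \<gamma> \<delta> m1 m2 n3 x y z]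
      unfolding partial_z_def K_def by simp
  qed
  have D: "?D x y field_differentiable at z"
    unfolding partial_x_minus_y_koornwinder_form[OF refl refl]
    unfolding field_differentiable_def by (rule exI, rule DERIV_cmult[OF jacobi_form_deriv_diagonal])
  have "?c * partial_z ?D x y z = deriv (\<lambda>s. ?c * ?D x y s) z"
    unfolding partial_z_def by (rule deriv_cmult[OF D, symmetric])
  also have "(\<lambda>s. ?c * ?D x y s) = (\<lambda>s. ?A * K (n1 - 1) n2 s - ?B * K n1 (n2 - 1) s)"
    unfolding K_def koornwinder_form_x_minus_y ..
  also have "deriv \<dots> z = ?A * (?k * ?K1) - ?B * (?k * ?K2)"
    by (intro DERIV_imp_deriv DERIV_diff DERIV_cmult dK)
  finally show ?thesis
    by (simp only: mult.assoc)
qed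

section \<open>Transfer to the simplex\<close>

lemma eventually_simplex3:
  fixes f :: "real \<Rightarrow> real \<times> real \<times> real"
  assumes "isCont f s" "f s \<in> simplex3"
  shows "\<forall>\<^sub>F r in nhds s. f r \<in> simplex3"
proof -
  have eq: "simplex3 = {v. 0 < fst v \<and> 0 < fst (snd v) \<and> 0 < snd (snd v)
      \<and> 0 < 1 - fst v - fst (snd v) - snd (snd v)}"
    by (auto simp: simplex3_def)
  have "open simplex3"
    unfolding eq by (intro open_Collect_conj open_Collect_less continuous_intros)
  then have "\<forall>\<^sub>F v in nhds (f s). v \<in> simplex3"
    using assms(2) by (rule eventually_nhds_in_open)
  moreover have "filterlim f (nhds (f s)) (nhds s)"
    using assms(1) by (simp only: isCont_def tendsto_at_iff_tendsto_nhds)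
  ultimately show ?thesis
    by (rule eventually_compose_filterlim)
qed

lemma partial_cong_simplex3:
  assumes "\<And>x y z. (x, y, z) \<in> simplex3 \<Longrightarrow> f x y z = g x y z" and "(x, y, z) \<in> simplex3"
  shows "partial_x f x y z = partial_x g x y z"
    and "partial_y f x y z = partial_y g x y z"
    and "partial_z f x y z = partial_z g x y z"
proof -
  have x: "\<forall>\<^sub>F s in nhds x. (s, y, z) \<in> simplex3"
    and y: "\<forall>\<^sub>F s in nhds y. (x, s, z) \<in> simplex3"
    and z: "\<forall>\<^sub>F s in nhds z. (x, y, s) \<in> simplex3"
    by (rule eventually_simplex3; use assms(2) in \<open>auto intro!: continuous_intros\<close>)+
  show "partial_x f x y z = partial_x g x y z"
    unfolding partial_x_def
    by (rule deriv_cong_ev) (use x in \<open>eventually_elim, simp add: assms(1)\<close>, simp)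
  show "partial_y f x y z = partial_y g x y z"
    unfolding partial_y_def
    by (rule deriv_cong_ev) (use y in \<open>eventually_elim, simp add: assms(1)\<close>, simp)
  show "partial_z f x y z = partial_z g x y z"
    unfolding partial_z_def
    by (rule deriv_cong_ev) (use z in \<open>eventually_elim, simp add: assms(1)\<close>, simp)
qed

theorem corollary6:
  fixes n1 n2 n3 n :: nat and \<alpha> \<beta> \<gamma> \<delta> x y z :: real
  assumes n: "n = n1 + n2 + n3"
    and xyz: "(x, y, z) \<in> simplex3"
  shows
    "((2 * real n2 + 2 * real n3 + \<beta> + \<gamma> + \<delta> + 2) *
       (partial_x (koornwinder \<alpha> \<beta> \<gamma> \<delta> (int n1) (int n2) (int n3)) x y z
        - partial_y (koornwinder \<alpha> \<beta> \<gamma> \<delta> (int n1) (int n2) (int n3)) x y z)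
     = (real n2 + 2 * real n3 + \<beta> + \<gamma> + \<delta> + 2) *
       (real n + real n2 + real n3 + \<alpha> + \<beta> + \<gamma> + \<delta> + 3) *
       koornwinder (\<alpha> + 1) (\<beta> + 1) \<gamma> \<delta> (int n1 - 1) (int n2) (int n3) x y z
     - (real n1 + 2 * real n2 + 2 * real n3 + \<beta> + \<gamma> + \<delta> + 2) *
       (real n2 + 2 * real n3 + \<gamma> + \<delta> + 1) *
       koornwinder (\<alpha> + 1) (\<beta> + 1) \<gamma> \<delta> (int n1) (int n2 - 1) (int n3) x y z)
   \<and>
    ((2 * real n3 + \<gamma> + \<delta> + 1) *
       (partial_z (koornwinder \<alpha> \<beta> \<gamma> \<delta> (int n1) (int n2) (int n3)) x y z
        - partial_y (koornwinder \<alpha> \<beta> \<gamma> \<delta> (int n1) (int n2) (int n3)) x y z)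
     = (real n3 + \<delta>) * (real n2 + 2 * real n3 + \<gamma> + \<delta> + 1) *
       koornwinder \<alpha> (\<beta> + 1) (\<gamma> + 1) \<delta> (int n1) (int n2) (int n3 - 1) x y z
     - (real n2 + 2 * real n3 + \<beta> + \<gamma> + \<delta> + 2) * (real n3 + \<gamma> + \<delta> + 1) *
       koornwinder \<alpha> (\<beta> + 1) (\<gamma> + 1) \<delta> (int n1) (int n2 - 1) (int n3) x y z)
   \<and>
    (partial_z (koornwinder \<alpha> \<beta> \<gamma> \<delta> (int n1) (int n2) (int n3)) x y z
     = (real n3 + \<gamma> + \<delta> + 1) *
       koornwinder \<alpha> \<beta> (\<gamma> + 1) (\<delta> + 1) (int n1) (int n2) (int n3 - 1) x y z)
   \<and>
    ((2 * real n2 + 2 * real n3 + \<beta> + \<gamma> + \<delta> + 2) *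
       partial_z (\<lambda>x y z.
         partial_x (koornwinder \<alpha> \<beta> \<gamma> \<delta> (int n1) (int n2) (int n3)) x y z
         - partial_y (koornwinder \<alpha> \<beta> \<gamma> \<delta> (int n1) (int n2) (int n3)) x y z) x y z
     = (real n2 + 2 * real n3 + \<beta> + \<gamma> + \<delta> + 2) *
       (real n + real n2 + real n3 + \<alpha> + \<beta> + \<gamma> + \<delta> + 3) *
       (real n3 + \<gamma> + \<delta> + 1) *
       koornwinder (\<alpha> + 1) (\<beta> + 1) (\<gamma> + 1) (\<delta> + 1) (int n1 - 1) (int n2) (int n3 - 1) x y z
     - (real n1 + 2 * real n2 + 2 * real n3 + \<beta> + \<gamma> + \<delta> + 2) *
       (real n2 + 2 * real n3 + \<gamma> + \<delta> + 1) *
       (real n3 + \<gamma> + \<delta> + 1) *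
       koornwinder (\<alpha> + 1) (\<beta> + 1) (\<gamma> + 1) (\<delta> + 1) (int n1) (int n2 - 1) (int n3 - 1) x y z)"
proof -
  let ?K = "koornwinder \<alpha> \<beta> \<gamma> \<delta> (int n1) (int n2) (int n3)"
  let ?F = "koornwinder_form \<alpha> \<beta> \<gamma> \<delta> (int n1) (int n2) (int n3)"
  have first_order:
    "partial_x ?K u v w = partial_x ?F u v w"
    "partial_y ?K u v w = partial_y ?F u v w"
    "partial_z ?K u v w = partial_z ?F u v w" if "(u, v, w) \<in> simplex3" for u v w
    using that by (intro partial_cong_simplex3 koornwinder_eq_form; simp)+
  \<comment> \<open>Both first derivatives agree on the whole open simplex, hence so do derivatives of their difference.\<close>
  have second_order:
    "partial_z (\<lambda>x y z. partial_x ?K x y z - partial_y ?K x y z) x y z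
      = partial_z (\<lambda>x y z. partial_x ?F x y z - partial_y ?F x y z) x y z"
    by (rule partial_cong_simplex3(3)[OF _ xyz]) (simp add: first_order)
  have n': "real n + real n2 + real n3 = real n1 + 2 * real n2 + 2 * real n3"
    by (simp add: n)
  show ?thesis
    unfolding first_order[OF xyz] second_order koornwinder_eq_form[OF xyz] n'
    using koornwinder_form_x_minus_y[of "int n2" "int n3" \<beta> \<gamma> \<delta> \<alpha> "int n1" x y z]
      koornwinder_form_z_minus_y[of "int n3" \<gamma> \<delta> \<alpha> \<beta> "int n1" "int n2" x y z]
      koornwinder_form_partial_z[of \<alpha> \<beta> \<gamma> \<delta> "int n1" "int n2" "int n3" x y z]
      koornwinder_form_z_x_minus_y[of "int n2" "int n3" \<beta> \<gamma> \<delta> \<alpha> "int n1" x y z]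
    by (simp only: of_int_of_nat_eq)
qed

end
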